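(* Let $X$ be a real Hilbert space, let $m\ge 2$ be an integer, and let $T_1,\ldots,T_m\colon X\to X$ be firmly nonexpansive. Then $$\|v_{T_m\cdots T_2T_1}\|\le \|v_{T_1}\|+\cdots+\|v_{T_m}\|,$$ where $T_m\cdots T_2T_1$ denotes the composition (with $T_1$ applied first) and $v_S$ denotes the minimal displacement vector of $S$.
   Context: $X$ is a real Hilbert space with inner product $\langle\cdot,\cdot\rangle$ and induced norm $\|\cdot\|$. A map $T\colon X\to X$ is firmly nonexpansive if $\|Tx-Ty\|^2\le\langle x-y,Tx-Ty\rangle$ for all $x,y\in X$. For a nonexpansive (i.e. 1-Lipschitz) map $S\colon X\to X$ (firmly nonexpansive maps and their compositions are nonexpansive), the set $\overline{\operatorname{ran}}(\operatorname{Id}-S)=\overline{\{x-Sx : x\in X\}}$ is nonempty, closed and convex, and the minimal displacement vector of $S$ is $v_S:=P_{\overline{\operatorname{ran}}(\operatorname{Id}-S)}(0)$, the projection of $0$ onto this set, i.e. its unique element of minimal norm. *)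

theory Defs
  imports "HOL-Analysis.Analysis"
begin

definition firmly_nonexpansive :: "('a::real_inner \<Rightarrow> 'a) \<Rightarrow> bool" where
  "firmly_nonexpansive T \<longleftrightarrow> (\<forall>x y. (norm (T x - T y))\<^sup>2 \<le> inner (x - y) (T x - T y))"

(* Metric projection onto a nonempty closed convex set. The library's closest_point
   is restricted to heine_borel spaces, that is, to finite dimension. *)
definition projection :: "'a::real_inner set \<Rightarrow> 'a \<Rightarrow> 'a" where
  "projection C x = (THE p. p \<in> C \<and> (\<forall>y\<in>C. dist x p \<le> dist x y))"

(* Meaningful for nonexpansive S on a Hilbert space: only then is the closure of
   the range of Id - S known to be convex, so that the projection exists and is unique. *)
definition min_displacement :: "('a::real_inner \<Rightarrow> 'a) \<Rightarrow> 'a" where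
  "min_displacement S = projection (closure (range (\<lambda>x. x - S x))) 0"

end

theory Submission
  imports Defs
begin

text \<open>
  Call a nonexpansive map \<open>S\<close> of quadratic growth about \<open>p\<close> if
  \<open>\<parallel>S w - p\<parallel>\<^sup>2 \<le> \<parallel>w - p\<parallel>\<^sup>2 + C\<close> for all \<open>w\<close>.  Such a map has almost fixed points: at the fixed point
  \<open>x\<close> of the contraction \<open>w \<mapsto> p + (1 - t) (S w - p)\<close> the growth condition bounds \<open>t \<parallel>x - p\<parallel>\<^sup>2\<close> by
  \<open>C\<close>, so \<open>\<parallel>x - S x\<parallel>\<^sup>2 = t\<^sup>2 \<parallel>S x - p\<parallel>\<^sup>2 = O(t)\<close>.

  This is used twice.  If \<open>x\<close> and \<open>y\<close> have displacements \<open>a\<close> and \<open>b\<close> under \<open>S\<close>, then \<open>S + (a + b)/2\<close>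
  has quadratic growth about \<open>(x + y)/2\<close>; hence the closure of the range of \<open>Id - S\<close> is midpoint
  convex, and the minimal displacement vector exists.  Secondly, pick \<open>y\<^sub>i\<close> such that
  \<open>a\<^sub>i = y\<^sub>i - T\<^sub>i y\<^sub>i\<close> is nearly as short as the minimal displacement vector of \<open>T\<^sub>i\<close>.  Then
  \<open>U\<^sub>i = T\<^sub>i(\<cdot> + a\<^sub>i)\<close> is firmly nonexpansive and fixes \<open>T\<^sub>i y\<^sub>i\<close>; firm nonexpansiveness
  makes the composition of the \<open>U\<^sub>i\<close> of quadratic growth about \<open>0\<close>.  An almost fixed point of it is
  moved by \<open>T\<^sub>m \<cdots> T\<^sub>1\<close> by at most about \<open>\<Sum> \<parallel>a\<^sub>i\<parallel>\<close>.
\<close>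

section \<open>Elements of minimal norm in midpoint convex closed sets\<close>

lemma midpoint_in_closure:
  fixes R :: "'a::real_normed_vector set"
  assumes "\<And>a b. a \<in> R \<Longrightarrow> b \<in> R \<Longrightarrow> midpoint a b \<in> closure R"
    and "a \<in> closure R" "b \<in> closure R"
  shows "midpoint a b \<in> closure R"
proof -
  obtain f g where f: "\<And>n. f n \<in> R" "f \<longlonglongrightarrow> a" and g: "\<And>n. g n \<in> R" "g \<longlonglongrightarrow> b"
    using assms(2,3) unfolding closure_sequential by metis
  have "(\<lambda>n. midpoint (f n) (g n)) \<longlonglongrightarrow> midpoint a b"
    unfolding midpoint_def by (intro tendsto_intros f g)
  with assms(1)[OF f(1) g(1)] show ?thesis
    by (rule closed_sequentially[OF closed_closure])
qed

lemma parallelogram_midpoint: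
  fixes a b :: "'a::real_inner"
  shows "(norm (a - b))\<^sup>2 = 2 * (norm a)\<^sup>2 + 2 * (norm b)\<^sup>2 - 4 * (norm (midpoint a b))\<^sup>2"
  by (simp add: midpoint_def power2_norm_eq_inner power_divide algebra_simps inner_commute)

text \<open>Midpoints stay in \<open>D\<close>, so their squared norm is at least the infimum
  \<open>d\<close>; the parallelogram identity then makes every minimizing sequence Cauchy, and the
  same estimate forces two minimizers to coincide.\<close>

lemma min_norm_exists_unique:
  fixes D :: "'a::{real_inner, complete_space} set"
  assumes "closed D" "D \<noteq> {}"
    and mid: "\<And>a b. a \<in> D \<Longrightarrow> b \<in> D \<Longrightarrow> midpoint a b \<in> D"
  shows "\<exists>!p. p \<in> D \<and> (\<forall>y\<in>D. norm p \<le> norm y)"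
proof -
  define d where "d = (INF y\<in>D. (norm y)\<^sup>2)"
  have bdd: "bdd_below ((\<lambda>y. (norm y)\<^sup>2) ` D)"
    by (intro bdd_belowI[of _ 0]) auto
  have lower: "d \<le> (norm y)\<^sup>2" if "y \<in> D" for y
    unfolding d_def using bdd that by (rule cINF_lower)
  have "\<exists>y\<in>D. (norm y)\<^sup>2 < d + inverse (real (Suc n))" for n
    using cINF_less_iff[OF assms(2) bdd, of "d + inverse (real (Suc n))"]
    unfolding d_def by simp
  then obtain f where fD: "\<And>n. f n \<in> D"
    and f: "\<And>n. (norm (f n))\<^sup>2 < d + inverse (real (Suc n))"
    by metis
  have gap: "(norm (a - b))\<^sup>2 \<le> 2 * ((norm a)\<^sup>2 - d) + 2 * ((norm b)\<^sup>2 - d)"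
    if "a \<in> D" "b \<in> D" for a b
    using lower[OF mid[OF that]] by (simp add: parallelogram_midpoint)
  have "Cauchy f"
  proof (rule CauchyI)
    fix e :: real assume "e > 0"
    \<comment> \<open>Matched to \<open>gap\<close>: two excesses below
      \<open>e\<^sup>2 / 4\<close>, each doubled, add up to less than
      \<open>e\<^sup>2\<close>.\<close>
    then obtain N where N: "inverse (real (Suc N)) < e\<^sup>2 / 4"
      using reals_Archimedean[of "e\<^sup>2 / 4"] by auto
    have near: "(norm (f i))\<^sup>2 - d < e\<^sup>2 / 4" if "i \<ge> N" for i
    proof -
      have "inverse (real (Suc i)) \<le> inverse (real (Suc N))"
        using that by (intro le_imp_inverse_le) auto
      also note N
      finally show ?thesis using f[of i] by simp
    qed
    have "norm (f i - f j) < e" if "i \<ge> N" "j \<ge> N" for i j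
    proof -
      have "(norm (f i - f j))\<^sup>2 < e\<^sup>2"
        using gap[OF fD fD, of i j] near[OF that(1)] near[OF that(2)] by simp
      then show ?thesis
        using \<open>e > 0\<close> by (auto intro: power2_less_imp_less)
    qed
    then show "\<exists>M. \<forall>m\<ge>M. \<forall>n\<ge>M. norm (f m - f n) < e" by blast
  qed
  then obtain p where p: "f \<longlonglongrightarrow> p"
    using Cauchy_convergent convergent_def by blast
  have pD: "p \<in> D"
    using closed_sequentially[OF assms(1)] fD p by blast
  have "(norm p)\<^sup>2 \<le> d + 0"
  proof (rule LIMSEQ_le)
    show "(\<lambda>n. (norm (f n))\<^sup>2) \<longlonglongrightarrow> (norm p)\<^sup>2" by (intro tendsto_intros p)
    show "(\<lambda>n. d + inverse (real (Suc n))) \<longlonglongrightarrow> d + 0"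
      by (intro tendsto_intros LIMSEQ_inverse_real_of_nat)
  qed (use f less_imp_le in blast)
  then have p_le_d: "(norm p)\<^sup>2 \<le> d" by simp
  have pmin: "norm p \<le> norm y" if "y \<in> D" for y
    using order_trans[OF p_le_d lower[OF that]] by simp
  have "q = p" if "q \<in> D" "\<forall>y\<in>D. norm q \<le> norm y" for q
  proof -
    have "(norm q)\<^sup>2 \<le> (norm p)\<^sup>2"
      using that pD by (auto intro: power_mono)
    then have "(norm (q - p))\<^sup>2 \<le> 0"
      using gap[OF that(1) pD] p_le_d by (smt (verit))
    then show ?thesis by simp
  qed
  then show ?thesis using pD pmin by blast
qed

section \<open>Almost fixed points and the minimal displacement vector\<close>

lemma almost_fixed_point:
  fixes S :: "'a::{real_inner, complete_space} \<Rightarrow> 'a"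
  assumes lip: "1-lipschitz_on UNIV S"
    and growth: "\<And>w. (norm (S w - p))\<^sup>2 \<le> (norm (w - p))\<^sup>2 + C"
    and "e > 0"
  shows "\<exists>x. norm (x - S x) < e"
proof -
  have C: "C \<ge> 0"
    by (rule order_trans[OF zero_le_power2]) (use growth[of p] in simp)
  \<comment> \<open>The bound \<open>1/2\<close> keeps \<open>t\<close> below 1; the other one gives
    \<open>t * C < e\<^sup>2\<close>, with \<open>C + 1\<close> guarding against
    \<open>C = 0\<close>.\<close>
  define t where "t = min (1/2) (e\<^sup>2 / (4 * (C + 1)))"
  have t: "0 < t" "t < 1"
    using C \<open>e > 0\<close> by (auto simp: t_def)
  have "t * (4 * (C + 1)) \<le> e\<^sup>2 / (4 * (C + 1)) * (4 * (C + 1))"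
    using C by (intro mult_right_mono) (auto simp: t_def)
  then have tC: "t * (4 * (C + 1)) \<le> e\<^sup>2"
    using C by simp
  have "\<exists>!x. p + (1 - t) *\<^sub>R (S x - p) = x"
  proof (rule banach_fix_type[where c = "1 - t"]; (intro allI)?)
    fix x y
    have "dist (S x) (S y) \<le> dist x y"
      using lipschitz_onD[OF lip, of x y] by simp
    then show "dist (p + (1 - t) *\<^sub>R (S x - p)) (p + (1 - t) *\<^sub>R (S y - p)) \<le> (1 - t) * dist x y"
      using t by (simp add: dist_norm flip: scaleR_diff_right)
  qed (use t in auto)
  then obtain x where x: "p + (1 - t) *\<^sub>R (S x - p) = x" by blast
  define s where "s = (norm (S x - p))\<^sup>2"
  have "x - p = (1 - t) *\<^sub>R (S x - p)"
    using x by (metis add_diff_cancel_left')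
  then have "(norm (x - p))\<^sup>2 = (1 - t)\<^sup>2 * s"
    by (simp add: s_def power_mult_distrib)
  then have "s \<le> (1 - t)\<^sup>2 * s + C"
    using growth[of x] by (simp add: s_def)
  moreover have "(1 - t)\<^sup>2 * s \<le> (1 - t) * s"
    using t by (intro mult_right_mono) (auto simp: s_def power2_eq_square mult_left_le)
  ultimately have ts: "t * s \<le> C" by (simp add: algebra_simps)
  have "x - S x = (p + (1 - t) *\<^sub>R (S x - p)) - S x" using x by simp
  also have "\<dots> = - (t *\<^sub>R (S x - p))" by (simp add: algebra_simps)
  finally have "(norm (x - S x))\<^sup>2 = t * (t * s)"
    by (simp add: s_def power_mult_distrib power2_eq_square)
  also have "\<dots> \<le> t * C" using ts t by simp
  also have "\<dots> < t * (4 * (C + 1))" using t C by simp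
  also have "\<dots> \<le> e\<^sup>2" by (rule tC)
  finally have "norm (x - S x) < e" using \<open>e > 0\<close> by (simp add: power2_less_imp_less)
  then show ?thesis by blast
qed

lemma midpoint_displacement:
  fixes S :: "'a::{real_inner, complete_space} \<Rightarrow> 'a"
  assumes lip: "1-lipschitz_on UNIV S"
  shows "midpoint (x - S x) (y - S y) \<in> closure (range (\<lambda>w. w - S w))"
proof -
  define c where "c = midpoint (x - S x) (y - S y)"
  define d where "d = (1/2) *\<^sub>R ((x - S x) - (y - S y))"
  define p where "p = midpoint x y"
  \<comment> \<open>After the shift by \<open>c\<close>, the points \<open>x\<close> and
    \<open>y\<close> move by opposite vectors, so their images still have midpoint
    \<open>p\<close>.\<close>
  have Sx: "S x + c = x - d" and Sy: "S y + c = y + d"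
    by (simp_all add: c_def d_def midpoint_def algebra_simps flip: scaleR_left.add)
  have dist: "dist (S u) (S v) \<le> dist u v" for u v
    using lipschitz_onD[OF lip, of u v] by simp
  have "1-lipschitz_on UNIV (\<lambda>w. S w + c)"
    using dist by (auto intro: lipschitz_onI)
  moreover have "(norm (S w + c - p))\<^sup>2 \<le> (norm (w - p))\<^sup>2 + (inner (x - y) d - (norm d)\<^sup>2)" for w
  proof -
    have "norm (S w + c - (S x + c)) \<le> norm (w - x)" "norm (S w + c - (S y + c)) \<le> norm (w - y)"
      using dist[of w x] dist[of w y] by (simp_all add: dist_norm)
    then have "(norm (S w + c - (x - d)))\<^sup>2 \<le> (norm (w - x))\<^sup>2"
        "(norm (S w + c - (y + d)))\<^sup>2 \<le> (norm (w - y))\<^sup>2"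
      unfolding Sx Sy by (auto intro: power_mono)
    moreover define q where "q = S w + c"
    \<comment> \<open>Both pairs \<open>x\<close>, \<open>y\<close> and \<open>x - d\<close>,
      \<open>y + d\<close> are centred at \<open>p\<close>. Hence the terms linear in
      \<open>q - p\<close> and \<open>w - p\<close> cancel in the sum, and only a constant
      remains.\<close>
    ultimately have "inner (q - (x - d)) (q - (x - d)) + inner (q - (y + d)) (q - (y + d))
        \<le> inner (w - x) (w - x) + inner (w - y) (w - y)"
      by (simp add: power2_norm_eq_inner)
    then have "(norm (q - p))\<^sup>2 \<le> (norm (w - p))\<^sup>2 + (inner (x - y) d - (norm d)\<^sup>2)"
      by (simp add: p_def midpoint_def power2_norm_eq_inner inner_diff_left inner_diff_right
          inner_add_left inner_add_right inner_commute field_simps)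
    then show ?thesis by (simp add: q_def)
  qed
  ultimately have "\<exists>w. norm (w - (S w + c)) < e" if "e > 0" for e
    using almost_fixed_point that by blast
  then show ?thesis
    unfolding closure_approachable c_def[symmetric] by (auto simp: dist_norm algebra_simps)
qed

text \<open>Shows that the definite description behind \<open>min_displacement\<close> denotes:
  \<open>midpoint_displacement\<close> supplies the convexity needed for a unique minimizer.\<close>

lemma min_displacement_props:
  fixes S :: "'a::{real_inner, complete_space} \<Rightarrow> 'a"
  assumes "1-lipschitz_on UNIV S"
  shows "min_displacement S \<in> closure (range (\<lambda>x. x - S x))"
    and "norm (min_displacement S) \<le> norm (x - S x)"
proof -
  define D where "D = closure (range (\<lambda>x. x - S x))"
  have "midpoint a b \<in> D" if "a \<in> D" "b \<in> D" for a b
    using that unfolding D_def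
  proof (rule midpoint_in_closure[rotated])
    fix a b assume "a \<in> range (\<lambda>x. x - S x)" "b \<in> range (\<lambda>x. x - S x)"
    then show "midpoint a b \<in> closure (range (\<lambda>x. x - S x))"
      using midpoint_displacement[OF assms] by (elim rangeE) (simp only:)
  qed
  moreover have in_D: "x - S x \<in> D" for x
    unfolding D_def by (rule subsetD[OF closure_subset rangeI])
  ultimately have "\<exists>!p. p \<in> D \<and> (\<forall>y\<in>D. norm p \<le> norm y)"
    by (intro min_norm_exists_unique) (use in_D in \<open>auto simp: D_def\<close>)
  then have "min_displacement S \<in> D \<and> (\<forall>y\<in>D. norm (min_displacement S) \<le> norm y)"
    unfolding min_displacement_def projection_def D_def[symmetric] dist_0_norm by (rule theI')
  then show "min_displacement S \<in> closure (range (\<lambda>x. x - S x))"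
    and "norm (min_displacement S) \<le> norm (x - S x)"
    using in_D by (auto simp: D_def)
qed

section \<open>Compositions of firmly nonexpansive maps\<close>

lemma firmly_nonexpansive_lipschitz:
  assumes "firmly_nonexpansive T"
  shows "1-lipschitz_on UNIV T"
proof (rule lipschitz_onI)
  fix x y
  have "norm (T x - T y) * norm (T x - T y) \<le> norm (x - y) * norm (T x - T y)"
    using assms norm_cauchy_schwarz[of "x - y" "T x - T y"]
    unfolding firmly_nonexpansive_def power2_eq_square by (meson order_trans)
  then have "norm (T x - T y) \<le> norm (x - y)"
    by (cases "norm (T x - T y) = 0") (auto simp: mult_le_cancel_right)
  then show "dist (T x) (T y) \<le> 1 * dist x y" by (simp add: dist_norm)
qed simp

lemma fold_lipschitz:
  assumes "\<And>i. i \<in> set is \<Longrightarrow> 1-lipschitz_on UNIV (T i)"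
  shows "1-lipschitz_on UNIV (fold T is)"
  using assms
proof (induction "is")
  case (Cons i "is")
  then show ?case
    using lipschitz_on_compose[of 1 UNIV "T i" 1 "fold T is"]
    by (auto intro: lipschitz_on_subset)
qed (simp add: lipschitz_on_def)

text \<open>Growth is measured from 0, not from \<open>z\<close>, so that bounds for maps with
  different fixed points add up along a composition. Nonexpansiveness alone would leave a term
  linear in \<open>w\<close>, as for the reflection of \<open>w\<close> to
  \<open>2z - w\<close>.\<close>

lemma firmly_nonexpansive_growth:
  assumes "firmly_nonexpansive U" "U z = z"
  shows "(norm (U w))\<^sup>2 \<le> (norm w)\<^sup>2 + (norm z)\<^sup>2"
proof -
  have "(norm (U w - z))\<^sup>2 \<le> inner (w - z) (U w - z)"
    using assms unfolding firmly_nonexpansive_def by metis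
  \<comment> \<open>Bounds the inner products left after expanding the first inequality by half of
    the sum of the squared norms of \<open>U w\<close>, \<open>w\<close> and
    \<open>z\<close>.\<close>
  moreover have "0 \<le> (norm (U w - w - z))\<^sup>2" by simp
  ultimately show ?thesis
    by (simp add: power2_norm_eq_inner algebra_simps inner_commute)
qed

lemma fold_growth:
  assumes "\<And>i. i \<in> set is \<Longrightarrow> firmly_nonexpansive (U i) \<and> U i (z i) = z i"
  shows "(norm (fold U is w))\<^sup>2 \<le> (norm w)\<^sup>2 + (\<Sum>i\<leftarrow>is. (norm (z i))\<^sup>2)"
  using assms
proof (induction "is" arbitrary: w)
  case (Cons i "is")
  then have "(norm (fold U is (U i w)))\<^sup>2 \<le> (norm (U i w))\<^sup>2 + (\<Sum>i\<leftarrow>is. (norm (z i))\<^sup>2)"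
    by simp
  moreover have "(norm (U i w))\<^sup>2 \<le> (norm w)\<^sup>2 + (norm (z i))\<^sup>2"
    using Cons.prems by (auto intro: firmly_nonexpansive_growth)
  ultimately show ?case by simp
qed simp

text \<open>Each shift adds at most \<open>norm (a i)\<close> to the error, and the later
  nonexpansive maps do not enlarge it.\<close>

lemma fold_perturbation:
  fixes a :: "'i \<Rightarrow> 'a::real_normed_vector"
  assumes "\<And>i. i \<in> set is \<Longrightarrow> 1-lipschitz_on UNIV (T i)"
  shows "norm (fold (\<lambda>i x. T i (x + a i)) is u - fold T is v) \<le> norm (u - v) + (\<Sum>i\<leftarrow>is. norm (a i))"
  using assms
proof (induction "is" arbitrary: u v)
  case (Cons i "is")
  have "norm (T i (u + a i) - T i v) \<le> norm (u + a i - v)"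
    using lipschitz_onD[of 1 UNIV "T i" "u + a i" v] Cons.prems by (simp add: dist_norm)
  also have "\<dots> \<le> norm (u - v) + norm (a i)"
    using norm_triangle_ineq[of "u - v" "a i"] by (simp add: algebra_simps)
  finally show ?case
    using Cons.IH[of "T i (u + a i)" "T i v"] Cons.prems by fastforce
qed simp

theorem theorem2p2:
  fixes T :: "nat \<Rightarrow> 'a::{real_inner, complete_space} \<Rightarrow> 'a" and m :: nat
  assumes "m \<ge> 2"
    and "\<And>i. i \<in> {1..m} \<Longrightarrow> firmly_nonexpansive (T i)"
  shows "norm (min_displacement (fold T [1..<Suc m])) \<le> (\<Sum>i=1..m. norm (min_displacement (T i)))"
proof (rule field_le_epsilon)
  fix e :: real assume "e > 0"
  \<comment> \<open>There are \<open>m + 1\<close> errors: one for each \<open>T i\<close>, and one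
    for the almost fixed point.\<close>
  define e' where "e' = e / (real m + 1)"
  have e': "e' > 0" "(real m + 1) * e' = e"
    using \<open>e > 0\<close> by (auto simp: e'_def)
  let ?is = "[1..<Suc m]"
  have firm: "firmly_nonexpansive (T i)" if "i \<in> set ?is" for i
    using assms(2) that by auto
  have lip: "1-lipschitz_on UNIV (T i)" if "i \<in> set ?is" for i
    using firm[OF that] by (rule firmly_nonexpansive_lipschitz)
  have "\<exists>y. norm (y - T i y) \<le> norm (min_displacement (T i)) + e'" if i: "i \<in> set ?is" for i
  proof -
    obtain y where "dist (y - T i y) (min_displacement (T i)) < e'"
      using min_displacement_props(1)[OF lip[OF i]] e'(1)
      unfolding closure_approachable by blast
    then show ?thesis
      using norm_triangle_ineq2[of "y - T i y" "min_displacement (T i)"]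
      by (intro exI[of _ y]) (simp add: dist_norm)
  qed
  then obtain y where y: "\<And>i. i \<in> set ?is \<Longrightarrow>
      norm (y i - T i (y i)) \<le> norm (min_displacement (T i)) + e'"
    by metis
  define a where "a i = y i - T i (y i)" for i
  define U where "U = (\<lambda>i x. T i (x + a i))"
  have U: "firmly_nonexpansive (U i) \<and> U i (T i (y i)) = T i (y i)" if "i \<in> set ?is" for i
  proof
    have "(norm (U i u - U i v))\<^sup>2 \<le> inner (u - v) (U i u - U i v)" for u v
      using firm[OF that, unfolded firmly_nonexpansive_def, rule_format, of "u + a i" "v + a i"]
      by (simp add: U_def)
    then show "firmly_nonexpansive (U i)" by (simp add: firmly_nonexpansive_def)
    show "U i (T i (y i)) = T i (y i)" by (simp add: U_def a_def)
  qed
  have "1-lipschitz_on UNIV (fold U ?is)"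
    using U by (intro fold_lipschitz firmly_nonexpansive_lipschitz) blast
  moreover have "(norm (fold U ?is w - 0))\<^sup>2
      \<le> (norm (w - 0))\<^sup>2 + (\<Sum>i\<leftarrow>?is. (norm (T i (y i)))\<^sup>2)" for w
    unfolding diff_zero by (rule fold_growth) (rule U)
  ultimately obtain x where x: "norm (x - fold U ?is x) < e'"
    using almost_fixed_point e'(1) by blast
  have "norm (min_displacement (fold T ?is)) \<le> norm (x - fold T ?is x)"
    by (intro min_displacement_props(2) fold_lipschitz lip)
  also have "\<dots> \<le> norm (x - fold U ?is x) + norm (fold U ?is x - fold T ?is x)"
    using norm_triangle_ineq[of "x - fold U ?is x" "fold U ?is x - fold T ?is x"] by simp
  also have "\<dots> \<le> e' + (\<Sum>i\<leftarrow>?is. norm (a i))"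
    using x fold_perturbation[of ?is T a x x, OF lip] unfolding U_def by simp
  also have "(\<Sum>i\<leftarrow>?is. norm (a i)) = (\<Sum>i=1..m. norm (a i))"
    unfolding sum_set_upt_conv_sum_list_nat[symmetric] set_upt atLeastLessThanSuc_atLeastAtMost ..
  also have "\<dots> \<le> (\<Sum>i=1..m. norm (min_displacement (T i)) + e')"
    unfolding a_def using y[unfolded set_upt atLeastLessThanSuc_atLeastAtMost]
    by (rule sum_mono)
  also have "\<dots> = (\<Sum>i=1..m. norm (min_displacement (T i))) + real m * e'"
    by (simp add: sum.distrib)
  finally show "norm (min_displacement (fold T ?is))
      \<le> (\<Sum>i=1..m. norm (min_displacement (T i))) + e"
    using e'(2) by (simp add: algebra_simps)
qed

end
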